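(* Let $(\Omega,\mathcal{F},P)$ be a probability space and let $\xi$ denote a random element of $\Omega$ with law $P$. Let $F:\mathbb{R}^d\times\Omega\to\mathbb{R}$ and assume $F(\cdot;\xi)$ is differentiable for all $\xi\in\Omega$. Let $f=\mathbb{E}[F(\cdot;\xi)]$. Assume $\nabla f=\mathbb{E}[\nabla F(\cdot;\xi)]$ and $\mathbb{E}[\|\nabla f(x)-\nabla F(x;\xi)\|^2]\le\sigma^2$ for all $x\in\mathbb{R}^d$, where $\sigma>0$. Let $\delta_{\mathrm{iter}},\delta_{\mathrm{emp}}\in(0,1)$, $T\in\mathbb{N}$, $\gamma>0$, and let $p_0,\dots,p_{T-1}\ge0$ with $\sum_{t=0}^{T-1}p_t=1$. Set $n_{\mathrm{iter}}=\lceil\log(1/\delta_{\mathrm{iter}})\rceil$ and $n_{\mathrm{emp}}=\lceil6(n_{\mathrm{iter}}+1)\sigma^2/(e\gamma\delta_{\mathrm{emp}})\rceil$. Apply the following procedure: 1. Sample $n_{\mathrm{iter}}$ indices independently with replacement from $\{0,\dots,T-1\}$ with probabilities $p_0,\dots,p_{T-1}$ to form the set $S=\{s_1,\dots,s_{n_{\mathrm{iter}}}\}$. 2. Sample $\xi_1,\dots,\xi_{n_{\mathrm{emp}}}$ independently from the law of $\xi$. 3. Run $T$ iterations of SGD with any step-size sequence $(\eta_t)$ to form $(x_t)$. 4. Choose $$x\in\{x_t:t\in S\}\quad\text{attaining}\quad\min_{t\in S}\left\|\frac1{n_{\mathrm{emp}}}\sum_{j=1}^{n_{\mathrm{emp}}}\nabla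 F(x_t;\xi_j)\right\|^2.$$ Then $$P\left(\|\nabla f(x)\|^2>5e\gamma\right)\le P\left(\sum_{t=0}^{T-1}p_t\|\nabla f(x_t)\|^2>\gamma\right)+\delta_{\mathrm{iter}}+\delta_{\mathrm{emp}}.$$
   Context: Norms are Euclidean; $e$ is Euler's number. SGD is the iteration $x_{t+1}=x_t-\eta_tg_t$, $t\ge0$, from a deterministic $x_0\in\mathbb{R}^d$, where $g_t$ is a random vector (an estimate of $\nabla f(x_t)$). The indices $(s_1,\dots,s_{n_{\mathrm{iter}}})$, the samples $(\xi_1,\dots,\xi_{n_{\mathrm{emp}}})$, and the randomness of the SGD run $(x_t)$ are mutually independent. In the displayed conclusion $P$ denotes probability over all of this randomness. *)

theory Defs
  imports "HOL-Probability.Probability"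
begin

text \<open>
  The library provides gradients only as the relation \<open>GDERIV\<close>; \<open>gradient h x\<close> is meaningful
  only where \<open>h\<close> is differentiable, and there the vector is unique.
\<close>

definition gradient :: "('a::real_inner \<Rightarrow> real) \<Rightarrow> 'a \<Rightarrow> 'a" where
  "gradient h x = (THE v. GDERIV h x :> v)"

lemma gradient_eqI:
  fixes h :: "'a::real_inner \<Rightarrow> real"
  assumes "GDERIV h x :> v"
  shows "gradient h x = v"
  unfolding gradient_def
proof (rule the_equality)
  show "GDERIV h x :> v" by (fact assms)
next
  fix u assume "GDERIV h x :> u"
  then have "(\<lambda>y. inner y u) = (\<lambda>y. inner y v)"
    using assms unfolding gderiv_def by (rule has_derivative_unique)
  then have "inner (u - v) u = inner (u - v) v" by meson
  then have "inner (u - v) (u - v) = 0" by (simp only: inner_diff_right)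
  then show "u = v" by simp
qed

lemma GDERIV_gradient:
  fixes h :: "'a::euclidean_space \<Rightarrow> real"
  assumes "h differentiable (at x)"
  shows "GDERIV h x :> gradient h x"
proof -
  obtain h' where h': "(h has_derivative h') (at x)"
    using assms unfolding differentiable_def by blast
  then have lin: "linear h'" by (rule has_derivative_linear)
  have "h' y = inner y (\<Sum>b\<in>Basis. h' b *\<^sub>R b)" for y
  proof -
    have "h' y = h' (\<Sum>b\<in>Basis. inner y b *\<^sub>R b)" by (simp add: euclidean_representation)
    also have "\<dots> = (\<Sum>b\<in>Basis. inner y b * h' b)"
      using lin by (simp add: linear_sum linear_scale)
    finally show ?thesis by (simp add: inner_sum_right mult.commute)
  qed
  then have "h' = (\<lambda>y. inner y (\<Sum>b\<in>Basis. h' b *\<^sub>R b))" by blast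
  with h' have "GDERIV h x :> (\<Sum>b\<in>Basis. h' b *\<^sub>R b)"
    unfolding gderiv_def by simp
  then show ?thesis by (simp add: gradient_eqI)
qed

definition empirical_gradient ::
  "('a::real_inner \<Rightarrow> 'w \<Rightarrow> real) \<Rightarrow> nat \<Rightarrow> (nat \<Rightarrow> 'w) \<Rightarrow> 'a \<Rightarrow> 'a" where
  "empirical_gradient F n \<xi> y = (1 / real n) *\<^sub>R (\<Sum>j\<in>{1..n}. gradient (\<lambda>z. F z (\<xi> j)) y)"

text \<open>
  \<open>indep_vars\<close> needs all variables to have the same value type.  The following is its
  defining condition (mutual independence of the generated sigma-algebras) for three
  variables of different types.
\<close>

datatype three = First | Second | Third

definition indep_vars3 ::
  "'m measure \<Rightarrow> 'a measure \<Rightarrow> ('m \<Rightarrow> 'a) \<Rightarrow> 'b measure \<Rightarrow> ('m \<Rightarrow> 'b) \<Rightarrow>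
    'c measure \<Rightarrow> ('m \<Rightarrow> 'c) \<Rightarrow> bool" where
  "indep_vars3 M A X B Y C Z \<longleftrightarrow>
    X \<in> measurable M A \<and> Y \<in> measurable M B \<and> Z \<in> measurable M C \<and>
    prob_space.indep_sets M
      (case_three {X -` U \<inter> space M | U. U \<in> sets A}
                  {Y -` U \<inter> space M | U. U \<in> sets B}
                  {Z -` U \<inter> space M | U. U \<in> sets C})
      UNIV"

end

theory Submission imports Defs begin

text \<open>
  Write \<open>G y = \<parallel>\<nabla>f(y)\<parallel>\<^sup>2\<close>, let \<open>h\<close> be the empirical gradient, and \<open>D y = \<parallel>h(y) - \<nabla>f(y)\<parallel>\<^sup>2\<close>.
  Three independent sources of randomness enter: the indices, the fresh samples and the trajectory.
  The output fails to have small gradient only if one of three things goes wrong.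

  \<^item> The weighted average of \<open>G\<close> over the trajectory exceeds \<open>\<gamma>\<close>.  This is the probability that
    remains on the right-hand side.

  \<^item> The average is at most \<open>\<gamma>\<close>, but every drawn iterate has \<open>G > e\<gamma>\<close>.  For a fixed trajectory,
    Markov's inequality for the weights \<open>p\<close> says that a single draw is that bad with probability at
    most \<open>1/e\<close>, so all \<open>n_iter\<close> independent draws are bad with probability at most
    \<open>exp (- n_iter) \<le> \<delta>_iter\<close> (\<open>prob_all_draws_above\<close>).

  \<^item> Some drawn iterate has \<open>D > e\<gamma>/6\<close>.  At a fixed point the expectation of \<open>D\<close>
    is at most \<open>\<sigma>\<^sup>2/n_emp\<close>, because the errors of independent samples are orthogonal; Markov's
    inequality then gives at most \<open>\<delta>_emp/(n_iter + 1)\<close> (\<open>prob_sample_mean_deviation\<close>), and a union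
    bound over the \<open>n_iter\<close> draws gives at most \<open>\<delta>_emp\<close>.

  If none of these happens, some drawn iterate \<open>z\<close> has \<open>G z \<le> e\<gamma>\<close>, and the output \<open>y\<close>, minimising
  \<open>\<parallel>h\<parallel>\<close> over the drawn iterates, satisfies
  \<open>G y \<le> 2\<parallel>h(y)\<parallel>\<^sup>2 + 2 D y \<le> 2\<parallel>h(z)\<parallel>\<^sup>2 + 2 D y \<le> 4 G z + 4 D z + 2 D y \<le> 5e\<gamma>\<close>
  (\<open>selected_norm_sq_bound\<close>).

  Both probability estimates are made at a deterministic point or trajectory and transferred to the
  random one by \<open>prob_le_of_sections_le\<close>, a form of Fubini's theorem.  It needs \<open>D\<close> to be jointly
  measurable in the point and the samples, although \<open>F\<close> is only assumed to be measurable in the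
  sample for each fixed point.  Differentiability supplies the rest: \<open>F\<close> is continuous in the
  point, hence jointly measurable, and its gradient is a limit of difference quotients.
\<close>

section \<open>Measurability of gradients in point and parameter\<close>

text \<open>
  Replacing \<open>y\<close> by a simple function \<open>a i y\<close> leaves finitely many sections \<open>F c\<close>, one for each
  value \<open>c\<close> and each measurable, so \<open>F (a i y) w\<close> is jointly measurable; by continuity it tends to \<open>F y w\<close> as \<open>a i y\<close> tends to \<open>y\<close>.
\<close>

lemma borel_measurable_case_prod_caratheodory:
  fixes F :: "'a::{metric_space, second_countable_topology} \<Rightarrow> 'w \<Rightarrow> 'b::metric_space"
  assumes cont: "\<And>w. w \<in> space N \<Longrightarrow> continuous_on UNIV (\<lambda>y. F y w)"
    and meas: "\<And>y. F y \<in> borel_measurable N"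
  shows "(\<lambda>(y, w). F y w) \<in> borel_measurable (borel \<Otimes>\<^sub>M N)"
proof -
  obtain a :: "nat \<Rightarrow> 'a \<Rightarrow> 'a" where a: "\<And>i. simple_function borel (a i)" "\<And>y. (\<lambda>i. a i y) \<longlonglongrightarrow> y"
    using borel_measurable_implies_sequence_metric[of "\<lambda>y::'a. y" borel undefined] by auto
  show ?thesis
  proof (rule borel_measurable_LIMSEQ_metric)
    fix i
    have fin: "finite (range (a i))"
      using simple_functionD(1)[OF a(1)[of i]] by simp
    have "a i \<in> borel \<rightarrow>\<^sub>M count_space (range (a i))"
      using simple_functionD(2)[OF a(1)[of i]] fin by (auto simp: measurable_count_space_eq2)
    then have "(\<lambda>z::'a \<times> 'w. a i (fst z)) \<in> borel \<Otimes>\<^sub>M N \<rightarrow>\<^sub>M count_space (range (a i))"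
      by (rule measurable_compose[OF measurable_fst])
    then show "(\<lambda>z. F (a i (fst z)) (snd z)) \<in> borel_measurable (borel \<Otimes>\<^sub>M N)"
      by (rule measurable_compose_countable'[rotated])
         (use fin in \<open>auto intro: countable_finite measurable_compose[OF measurable_snd meas]\<close>)
  next
    fix z :: "'a \<times> 'w" assume "z \<in> space (borel \<Otimes>\<^sub>M N)"
    then have "snd z \<in> space N" by (auto simp: space_pair_measure)
    then have "isCont (\<lambda>y. F y (snd z)) (fst z)"
      using cont by (auto simp: continuous_on_eq_continuous_at)
    then show "(\<lambda>i. F (a i (fst z)) (snd z)) \<longlonglongrightarrow> (case z of (y, w) \<Rightarrow> F y w)"
      unfolding case_prod_beta by (rule isCont_tendsto_compose) (rule a(2))
  qed
qed

text \<open>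
  Difference quotients along a fixed sequence of steps, which makes their limit a sequential one, as
  measurability requires.
\<close>

lemma GDERIV_directional_limit:
  fixes h :: "'a::real_inner \<Rightarrow> real"
  assumes "GDERIV h x :> v"
  shows "(\<lambda>n. (h (x + inverse (real (Suc n)) *\<^sub>R b) - h x) / inverse (real (Suc n)))
           \<longlonglongrightarrow> inner b v"
proof -
  have "((\<lambda>t. h (x + t *\<^sub>R b)) has_derivative (\<lambda>t. inner (t *\<^sub>R b) v)) (at (0::real))"
  proof (rule has_derivative_compose[where f = "\<lambda>t. x + t *\<^sub>R b" and g = h])
    show "((\<lambda>t. x + t *\<^sub>R b) has_derivative (\<lambda>t. t *\<^sub>R b)) (at (0::real))"
      by (auto intro!: derivative_eq_intros)
    show "(h has_derivative (\<lambda>u. inner u v)) (at (x + 0 *\<^sub>R b))"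
      using assms by (simp add: gderiv_def)
  qed
  then have "DERIV (\<lambda>t. h (x + t *\<^sub>R b)) 0 :> inner b v"
    by (simp add: has_field_derivative_def mult.commute[of _ "inner b v"])
  then have "((\<lambda>t. (h (x + t *\<^sub>R b) - h x) / t) \<longlongrightarrow> inner b v) (at 0)"
    by (simp add: DERIV_def)
  moreover have "filterlim (\<lambda>n. inverse (real (Suc n))) (at 0) sequentially"
    unfolding filterlim_at using LIMSEQ_inverse_real_of_nat by auto
  ultimately show ?thesis
    by (rule filterlim_compose)
qed

text \<open>
  The components of the gradient are limits of difference quotients along the coordinate axes.  The
  base point \<open>X w\<close> may vary with the parameter, so that the lemma covers a gradient taken jointly in
  point and parameter as well as the gradient of a single function.
\<close>

lemma borel_measurable_gradient:
  fixes h :: "'w \<Rightarrow> 'a::euclidean_space \<Rightarrow> real"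
  assumes diff: "\<And>w. w \<in> space N \<Longrightarrow> h w differentiable (at (X w))"
    and meas: "\<And>c. (\<lambda>w. h w (X w + c)) \<in> borel_measurable N"
  shows "(\<lambda>w. gradient (h w) (X w)) \<in> borel_measurable N"
proof (rule borel_measurable_euclidean_space[THEN iffD2], rule ballI)
  fix b :: 'a assume "b \<in> Basis"
  show "(\<lambda>w. gradient (h w) (X w) \<bullet> b) \<in> borel_measurable N"
  proof (rule borel_measurable_LIMSEQ_real)
    fix w assume "w \<in> space N"
    then show "(\<lambda>n. (h w (X w + inverse (real (Suc n)) *\<^sub>R b) - h w (X w)) / inverse (real (Suc n)))
        \<longlonglongrightarrow> gradient (h w) (X w) \<bullet> b"
      using GDERIV_directional_limit[OF GDERIV_gradient[OF diff]] by (simp only: inner_commute)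
  next
    show "(\<lambda>w. (h w (X w + inverse (real (Suc n)) *\<^sub>R b) - h w (X w)) / inverse (real (Suc n)))
        \<in> borel_measurable N" for n
      using meas[of "inverse (real (Suc n)) *\<^sub>R b"] meas[of 0] by simp
  qed
qed

lemma borel_measurable_case_prod_gradient:
  fixes F :: "'a::euclidean_space \<Rightarrow> 'w \<Rightarrow> real"
  assumes diff: "\<And>y w. w \<in> space N \<Longrightarrow> (\<lambda>z. F z w) differentiable (at y)"
    and meas: "\<And>y. F y \<in> borel_measurable N"
  shows "(\<lambda>(y, w). gradient (\<lambda>z. F z w) y) \<in> borel_measurable (borel \<Otimes>\<^sub>M N)"
  unfolding case_prod_beta
proof (rule borel_measurable_gradient)
  fix z :: "'a \<times> 'w" assume "z \<in> space (borel \<Otimes>\<^sub>M N)"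
  then show "(\<lambda>y. F y (snd z)) differentiable (at (fst z))"
    by (auto simp: space_pair_measure intro: diff)
next
  fix c :: 'a
  have F: "(\<lambda>(y, w). F y w) \<in> borel_measurable (borel \<Otimes>\<^sub>M N)"
    by (rule borel_measurable_case_prod_caratheodory)
       (simp_all add: meas diff differentiable_imp_continuous_on differentiable_on_def)
  have "(\<lambda>z. (fst z + c, snd z)) \<in> (borel \<Otimes>\<^sub>M N) \<rightarrow>\<^sub>M (borel \<Otimes>\<^sub>M N)"
    by measurable
  from measurable_compose[OF this F]
  show "(\<lambda>z. F (fst z + c) (snd z)) \<in> borel_measurable (borel \<Otimes>\<^sub>M N)"
    by simp
qed

lemma borel_measurable_gradient_of_differentiable:
  fixes f :: "'a::euclidean_space \<Rightarrow> real"
  assumes "\<And>y. f differentiable (at y)"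
  shows "gradient f \<in> borel_measurable borel"
proof (rule borel_measurable_gradient[where h = "\<lambda>_. f" and X = "\<lambda>y. y"])
  have "continuous_on UNIV f"
    by (simp add: assms differentiable_imp_continuous_on differentiable_on_def)
  then have f: "f \<in> borel_measurable borel"
    by (rule borel_measurable_continuous_onI)
  show "(\<lambda>y. f (y + c)) \<in> borel_measurable borel" for c
    by (rule measurable_compose[OF _ f]) simp
qed (rule assms)

lemma borel_measurable_empirical_gradient:
  fixes F :: "'a::euclidean_space \<Rightarrow> 'w \<Rightarrow> real"
  assumes "\<And>y w. w \<in> space P \<Longrightarrow> (\<lambda>z. F z w) differentiable (at y)"
    and "\<And>y. F y \<in> borel_measurable P"
  shows "(\<lambda>(y, k). empirical_gradient F n k y) \<in> borel_measurable (borel \<Otimes>\<^sub>M Pi\<^sub>M {1..n} (\<lambda>_. P))"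
proof -
  have "(\<lambda>z. gradient (\<lambda>y. F y (snd z j)) (fst z)) \<in> borel_measurable (borel \<Otimes>\<^sub>M Pi\<^sub>M {1..n} (\<lambda>_. P))"
    if "j \<in> {1..n}" for j
  proof -
    have "(\<lambda>z. (fst z, snd z j)) \<in> (borel \<Otimes>\<^sub>M Pi\<^sub>M {1..n} (\<lambda>_. P)) \<rightarrow>\<^sub>M (borel \<Otimes>\<^sub>M P)"
      using that by measurable
    from measurable_compose[OF this borel_measurable_case_prod_gradient[OF assms]]
    show ?thesis by simp
  qed
  then show ?thesis
    unfolding empirical_gradient_def case_prod_beta
    by (intro borel_measurable_scaleR borel_measurable_const borel_measurable_sum) auto
qed

section \<open>Mean-square deviation of a sample mean\<close>

lemma (in prob_space) expectation_inner_indep_centered: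
  fixes Y Z :: "'a \<Rightarrow> 'b::euclidean_space"
  assumes ind: "indep_var borel Y borel Z"
    and Y: "integrable M Y" and Z: "integrable M Z" and zero: "expectation Y = 0"
  shows "expectation (\<lambda>\<omega>. Y \<omega> \<bullet> Z \<omega>) = 0" "integrable M (\<lambda>\<omega>. Y \<omega> \<bullet> Z \<omega>)"
proof -
  have coord: "integrable M (\<lambda>\<omega>. (Y \<omega> \<bullet> b) * (Z \<omega> \<bullet> b))"
      "expectation (\<lambda>\<omega>. (Y \<omega> \<bullet> b) * (Z \<omega> \<bullet> b)) = 0" for b
  proof -
    have i: "indep_var borel ((\<lambda>v. v \<bullet> b) \<circ> Y) borel ((\<lambda>v. v \<bullet> b) \<circ> Z)"
      by (rule indep_var_compose[OF ind]) auto
    have e: "expectation (\<lambda>\<omega>. Y \<omega> \<bullet> b) = 0"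
      using zero Y by simp
    have int: "integrable M ((\<lambda>v. v \<bullet> b) \<circ> Y)" "integrable M ((\<lambda>v. v \<bullet> b) \<circ> Z)"
      using Y Z by (auto simp: comp_def)
    show "integrable M (\<lambda>\<omega>. (Y \<omega> \<bullet> b) * (Z \<omega> \<bullet> b))"
      using indep_var_integrable[OF i int] by (simp add: comp_def)
    show "expectation (\<lambda>\<omega>. (Y \<omega> \<bullet> b) * (Z \<omega> \<bullet> b)) = 0"
      using indep_var_lebesgue_integral[OF i int] e by (simp add: comp_def)
  qed
  have sum: "(\<lambda>\<omega>. Y \<omega> \<bullet> Z \<omega>) = (\<lambda>\<omega>. \<Sum>b\<in>Basis. (Y \<omega> \<bullet> b) * (Z \<omega> \<bullet> b))"
    by (rule ext) (rule euclidean_inner)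
  show "expectation (\<lambda>\<omega>. Y \<omega> \<bullet> Z \<omega>) = 0" "integrable M (\<lambda>\<omega>. Y \<omega> \<bullet> Z \<omega>)"
    unfolding sum by (simp_all add: coord Bochner_Integration.integral_sum)
qed

text \<open>
  The variance of a sum of independent vectors is the sum of the variances: expanding the square, the
  mixed inner products vanish in expectation.
\<close>

lemma (in prob_space) expectation_norm_sq_sum_indep_centered:
  fixes Y :: "'i \<Rightarrow> 'a \<Rightarrow> 'b::euclidean_space"
  assumes fin: "finite I" and ind: "indep_vars (\<lambda>_. borel) Y I"
    and int: "\<And>i. i \<in> I \<Longrightarrow> integrable M (Y i)"
    and sq: "\<And>i. i \<in> I \<Longrightarrow> integrable M (\<lambda>\<omega>. (norm (Y i \<omega>))\<^sup>2)"
    and zero: "\<And>i. i \<in> I \<Longrightarrow> expectation (Y i) = 0"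
  shows "integrable M (\<lambda>\<omega>. (norm (\<Sum>i\<in>I. Y i \<omega>))\<^sup>2)"
    and "expectation (\<lambda>\<omega>. (norm (\<Sum>i\<in>I. Y i \<omega>))\<^sup>2) = (\<Sum>i\<in>I. expectation (\<lambda>\<omega>. (norm (Y i \<omega>))\<^sup>2))"
proof -
  have cross: "integrable M (\<lambda>\<omega>. Y i \<omega> \<bullet> Y j \<omega>) \<and>
      expectation (\<lambda>\<omega>. Y i \<omega> \<bullet> Y j \<omega>) = (if i = j then expectation (\<lambda>\<omega>. (norm (Y i \<omega>))\<^sup>2) else 0)"
    if "i \<in> I" "j \<in> I" for i j
  proof (cases "i = j")
    case True
    then show ?thesis using sq that by (simp add: power2_norm_eq_inner)
  next
    case False
    have "indep_var borel ((\<lambda>v. v i) \<circ> (\<lambda>\<omega>. restrict (\<lambda>k. Y k \<omega>) {i}))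
        borel ((\<lambda>v. v j) \<circ> (\<lambda>\<omega>. restrict (\<lambda>k. Y k \<omega>) {j}))"
      by (rule indep_var_compose[OF indep_var_restrict[OF ind]]) (use that False in auto)
    then have "indep_var borel (Y i) borel (Y j)"
      by (simp add: comp_def)
    from expectation_inner_indep_centered[OF this] show ?thesis
      using int zero that False by auto
  qed
  have expand: "(norm (\<Sum>i\<in>I. Y i \<omega>))\<^sup>2 = (\<Sum>i\<in>I. \<Sum>j\<in>I. Y i \<omega> \<bullet> Y j \<omega>)" for \<omega>
    by (simp only: power2_norm_eq_inner inner_sum_left) (simp only: inner_sum_right)
  show "integrable M (\<lambda>\<omega>. (norm (\<Sum>i\<in>I. Y i \<omega>))\<^sup>2)"
    unfolding expand using cross by auto
  have "expectation (\<lambda>\<omega>. (norm (\<Sum>i\<in>I. Y i \<omega>))\<^sup>2) = (\<Sum>i\<in>I. \<Sum>j\<in>I. expectation (\<lambda>\<omega>. Y i \<omega> \<bullet> Y j \<omega>))"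
    unfolding expand using cross by (simp add: Bochner_Integration.integral_sum)
  also have "\<dots> = (\<Sum>i\<in>I. expectation (\<lambda>\<omega>. (norm (Y i \<omega>))\<^sup>2))"
    using cross fin by simp
  finally show "expectation (\<lambda>\<omega>. (norm (\<Sum>i\<in>I. Y i \<omega>))\<^sup>2) = (\<Sum>i\<in>I. expectation (\<lambda>\<omega>. (norm (Y i \<omega>))\<^sup>2))" .
qed

text \<open>
  Markov's inequality for the squared deviation: its expectation is \<open>1/n\<^sup>2\<close> times a sum of \<open>n\<close>
  variances, each at most \<open>\<sigma>\<^sup>2\<close>.
\<close>

lemma (in prob_space) prob_sample_mean_deviation:
  fixes h :: "'w \<Rightarrow> 'b::euclidean_space"
  assumes ind: "indep_vars (\<lambda>_. P) \<xi> {1..n}"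
    and dist: "\<And>j. j \<in> {1..n} \<Longrightarrow> distr M P (\<xi> j) = P"
    and h: "integrable P h" and mean: "\<mu> = (\<integral>w. h w \<partial>P)"
    and var: "(\<integral>\<^sup>+w. ennreal ((norm (\<mu> - h w))\<^sup>2) \<partial>P) \<le> ennreal (\<sigma>\<^sup>2)"
    and n: "0 < n" and c: "0 < c"
  shows "prob {\<omega> \<in> space M. c < (norm ((1 / real n) *\<^sub>R (\<Sum>j\<in>{1..n}. h (\<xi> j \<omega>)) - \<mu>))\<^sup>2}
    \<le> \<sigma>\<^sup>2 / (real n * c)"
proof -
  define Y where "Y j \<omega> = h (\<xi> j \<omega>) - \<mu>" for j \<omega>
  have hm[measurable]: "h \<in> borel_measurable P" using h by auto
  have \<xi>: "\<xi> j \<in> M \<rightarrow>\<^sub>M P" if "j \<in> {1..n}" for j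
    using ind that by (auto simp: indep_vars_def)
  have "prob_space P"
    using prob_space_distr[OF \<xi>, of 1] dist[of 1] n by simp
  then interpret P: prob_space P .
  have sq: "integrable P (\<lambda>w. (norm (h w - \<mu>))\<^sup>2)"
    using var by (intro integrableI_bounded) (auto simp: norm_minus_commute le_less_trans)
  have "ennreal (\<integral>w. (norm (h w - \<mu>))\<^sup>2 \<partial>P) \<le> ennreal (\<sigma>\<^sup>2)"
    using var nn_integral_eq_integral[OF sq] by (simp add: norm_minus_commute)
  then have sq_le: "(\<integral>w. (norm (h w - \<mu>))\<^sup>2 \<partial>P) \<le> \<sigma>\<^sup>2"
    by simp
  have indY: "indep_vars (\<lambda>_. borel) Y {1..n}"
    unfolding Y_def by (rule indep_vars_compose2[OF ind]) simp
  have transfer: "integrable M (\<lambda>\<omega>. k (\<xi> j \<omega>))" "expectation (\<lambda>\<omega>. k (\<xi> j \<omega>)) = (\<integral>w. k w \<partial>P)"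
    if "j \<in> {1..n}" "integrable P k" for j and k :: "'w \<Rightarrow> 'c::euclidean_space"
    using integrable_distr_eq[OF \<xi>[OF that(1)], of k] integral_distr[OF \<xi>[OF that(1)], of k]
      dist[OF that(1)] that(2) by auto
  have Y: "integrable M (Y j)" "expectation (Y j) = 0" if "j \<in> {1..n}" for j
    using transfer[OF that, of "\<lambda>w. h w - \<mu>"] h mean unfolding Y_def
    by (auto simp: P.prob_space)
  have Ysq: "integrable M (\<lambda>\<omega>. (norm (Y j \<omega>))\<^sup>2)" "expectation (\<lambda>\<omega>. (norm (Y j \<omega>))\<^sup>2) \<le> \<sigma>\<^sup>2"
    if "j \<in> {1..n}" for j
    using transfer[OF that sq] sq_le unfolding Y_def by auto
  note sum = expectation_norm_sq_sum_indep_centered[OF _ indY Y(1) Ysq(1) Y(2), simplified]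
  define d where "d \<omega> = (norm ((1 / real n) *\<^sub>R (\<Sum>j\<in>{1..n}. h (\<xi> j \<omega>)) - \<mu>))\<^sup>2" for \<omega>
  have d: "d \<omega> = (1 / (real n)\<^sup>2) * (norm (\<Sum>j\<in>{1..n}. Y j \<omega>))\<^sup>2" for \<omega>
  proof -
    have "(1 / real n) *\<^sub>R (\<Sum>j\<in>{1..n}. h (\<xi> j \<omega>)) - \<mu> = (1 / real n) *\<^sub>R (\<Sum>j\<in>{1..n}. Y j \<omega>)"
      using n by (simp add: Y_def sum_subtractf scaleR_right_diff_distrib sum_constant_scaleR)
    then show ?thesis
      by (simp add: d_def power_mult_distrib power_divide)
  qed
  have d_nonneg: "0 \<le> d \<omega>" for \<omega> by (simp add: d_def)
  have dint: "integrable M d"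
    unfolding d[abs_def] using sum(1) by simp
  have "expectation d = (1 / (real n)\<^sup>2) * (\<Sum>j\<in>{1..n}. expectation (\<lambda>\<omega>. (norm (Y j \<omega>))\<^sup>2))"
    unfolding d[abs_def] using sum by simp
  also have "\<dots> \<le> (1 / (real n)\<^sup>2) * (\<Sum>j\<in>{1..n}. \<sigma>\<^sup>2)"
    by (intro mult_left_mono sum_mono Ysq(2)) auto
  also have "\<dots> = \<sigma>\<^sup>2 / real n"
    using n by (simp add: power2_eq_square)
  finally have E: "expectation d \<le> \<sigma>\<^sup>2 / real n" .
  have [measurable]: "d \<in> borel_measurable M" using dint by auto
  have "prob {\<omega> \<in> space M. c < d \<omega>} \<le> prob {\<omega> \<in> space M. d \<omega> \<ge> c}"
    by (rule finite_measure_mono) auto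
  also have "\<dots> \<le> expectation d / c"
    by (rule integral_Markov_inequality_measure[where A = "{}"]) (use dint c d_nonneg in auto)
  also have "\<dots> \<le> (\<sigma>\<^sup>2 / real n) / c"
    using E c by (intro divide_right_mono) auto
  finally show ?thesis unfolding d_def by simp
qed

section \<open>Product rules and a Fubini bound\<close>

text \<open>
  The three variables have different value types, so their independence is used below in the form of
  product rules for preimages rather than as \<open>indep_var\<close>, whose two variables share a value type.
\<close>

lemma (in prob_space) prob_vimages_indep_vars3:
  assumes ind: "indep_vars3 M A X B Y C Z"
    and "U \<in> sets A" "V \<in> sets B" "W \<in> sets C"
  shows "prob (X -` U \<inter> Y -` V \<inter> Z -` W \<inter> space M)
    = prob (X -` U \<inter> space M) * prob (Y -` V \<inter> space M) * prob (Z -` W \<inter> space M)"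
proof -
  have UNIV_three: "UNIV = {First, Second, Third}"
    by (metis UNIV_eq_I insert_iff three.exhaust)
  let ?E = "case_three (X -` U \<inter> space M) (Y -` V \<inter> space M) (Z -` W \<inter> space M)"
  have "prob (\<Inter>j\<in>UNIV. ?E j) = (\<Prod>j\<in>UNIV. prob (?E j))"
  proof (rule indep_setsD)
    show "indep_sets (case_three {X -` U \<inter> space M | U. U \<in> sets A}
        {Y -` U \<inter> space M | U. U \<in> sets B} {Z -` U \<inter> space M | U. U \<in> sets C}) UNIV"
      using ind by (simp add: indep_vars3_def)
    show "finite (UNIV :: three set)" by (simp add: UNIV_three)
  qed (use assms in \<open>auto split: three.split\<close>)
  moreover have "(\<Inter>j\<in>UNIV. ?E j) = X -` U \<inter> Y -` V \<inter> Z -` W \<inter> space M"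
    unfolding UNIV_three by auto
  ultimately show ?thesis by (simp add: UNIV_three)
qed

lemma Int_stable_vimages: "Int_stable {X -` U \<inter> \<Omega> |U. U \<in> sets A}"
proof (rule Int_stableI)
  fix a b assume "a \<in> {X -` U \<inter> \<Omega> |U. U \<in> sets A}" "b \<in> {X -` U \<inter> \<Omega> |U. U \<in> sets A}"
  then obtain U V where "U \<in> sets A" "a = X -` U \<inter> \<Omega>" "V \<in> sets A" "b = X -` V \<inter> \<Omega>"
    by auto
  then have "U \<inter> V \<in> sets A \<and> a \<inter> b = X -` (U \<inter> V) \<inter> \<Omega>" by auto
  then show "a \<inter> b \<in> {X -` U \<inter> \<Omega> |U. U \<in> sets A}" by blast
qed

lemma (in prob_space) prob_vimages_third_first:
  assumes ind: "indep_vars3 M A X B Y C Z" and U: "U \<in> sets A" and W: "W \<in> sets C"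
  shows "prob (Z -` W \<inter> X -` U \<inter> space M) = prob (Z -` W \<inter> space M) * prob (X -` U \<inter> space M)"
proof -
  have "random_variable B Y"
    using ind by (auto simp: indep_vars3_def)
  then have all: "Y -` space B \<inter> space M = space M"
    by (auto dest: measurable_space)
  then have "Z -` W \<inter> X -` U \<inter> space M = X -` U \<inter> Y -` space B \<inter> Z -` W \<inter> space M"
    by blast
  then show ?thesis
    using prob_vimages_indep_vars3[OF ind U sets.top W] all by (simp add: prob_space)
qed

text \<open>
  A pair of the variables is independent of the remaining one: the preimages of rectangles under the
  pair form an intersection-stable generator on which the product rule is immediate, and independence
  passes to generated sigma-algebras.
\<close>

lemma (in prob_space) prob_vimages_pair_second:
  assumes ind: "indep_vars3 M A X B Y C Z" and Q: "Q \<in> sets (A \<Otimes>\<^sub>M C)" and V: "V \<in> sets B"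
  shows "prob ((\<lambda>\<omega>. (X \<omega>, Z \<omega>)) -` Q \<inter> Y -` V \<inter> space M)
    = prob ((\<lambda>\<omega>. (X \<omega>, Z \<omega>)) -` Q \<inter> space M) * prob (Y -` V \<inter> space M)"
proof -
  have X: "random_variable A X" and Y: "random_variable B Y" and Z: "random_variable C Z"
    using ind by (auto simp: indep_vars3_def)
  let ?XZ = "\<lambda>\<omega>. (X \<omega>, Z \<omega>)"
  let ?rect = "{U \<times> W |U W. U \<in> sets A \<and> W \<in> sets C}"
  let ?R = "{?XZ -` Q \<inter> space M |Q. Q \<in> ?rect}"
  have gen: "{?XZ -` Q \<inter> space M |Q. Q \<in> sets (A \<Otimes>\<^sub>M C)} = sigma_sets (space M) ?R"
    unfolding sets_pair_measure
    by (rule sigma_sets_vimage_commute) (use X Z in \<open>auto dest: measurable_space\<close>)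
  have "indep_set (sigma_sets (space M) ?R)
      (sigma_sets (space M) {Y -` V \<inter> space M |V. V \<in> sets B})"
  proof (intro indep_set_sigma_sets Int_stable_vimages)
    show "Int_stable ?R"
    proof (rule Int_stableI)
      fix a b assume "a \<in> ?R" "b \<in> ?R"
      then obtain U W U' W' where
        "U \<in> sets A" "W \<in> sets C" "a = ?XZ -` (U \<times> W) \<inter> space M"
        "U' \<in> sets A" "W' \<in> sets C" "b = ?XZ -` (U' \<times> W') \<inter> space M"
        by auto
      then have "(U \<inter> U') \<times> (W \<inter> W') \<in> ?rect \<and> a \<inter> b = ?XZ -` ((U \<inter> U') \<times> (W \<inter> W')) \<inter> space M"
        by auto
      then show "a \<inter> b \<in> ?R" by blast
    qed
    show "indep_set ?R {Y -` V \<inter> space M |V. V \<in> sets B}"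
    proof (rule indep_setI)
      fix a b assume "a \<in> ?R" "b \<in> {Y -` V \<inter> space M |V. V \<in> sets B}"
      then obtain U W V where sets: "U \<in> sets A" "W \<in> sets C" "V \<in> sets B"
        and a: "a = ?XZ -` (U \<times> W) \<inter> space M" and b: "b = Y -` V \<inter> space M"
        by auto
      have "Y -` space B \<inter> space M = space M"
        using Y by (auto dest: measurable_space)
      moreover have "a = X -` U \<inter> Y -` space B \<inter> Z -` W \<inter> space M"
        using a measurable_space[OF Y] by auto
      moreover have "a \<inter> b = X -` U \<inter> Y -` V \<inter> Z -` W \<inter> space M"
        using a b by auto
      ultimately show "prob (a \<inter> b) = prob a * prob b"
        using prob_vimages_indep_vars3[OF ind sets(1) sets(3) sets(2)]
          prob_vimages_indep_vars3[OF ind sets(1) sets.top sets(2)] b by (simp add: prob_space)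
    next
      have "?XZ \<in> M \<rightarrow>\<^sub>M A \<Otimes>\<^sub>M C" using X Z by (rule measurable_Pair)
      then show "?R \<subseteq> events" by (auto intro!: measurable_sets)
    qed (use Y in \<open>auto intro: measurable_sets\<close>)
  qed
  then have "prob ((?XZ -` Q \<inter> space M) \<inter> (Y -` V \<inter> space M))
      = prob (?XZ -` Q \<inter> space M) * prob (Y -` V \<inter> space M)"
  proof (rule indep_setD)
    show "?XZ -` Q \<inter> space M \<in> sigma_sets (space M) ?R"
      using Q gen by blast
    show "Y -` V \<inter> space M \<in> sigma_sets (space M) {Y -` V \<inter> space M |V. V \<in> sets B}"
      using V by (auto intro: sigma_sets.Basic)
  qed
  moreover have "(?XZ -` Q \<inter> space M) \<inter> (Y -` V \<inter> space M) = ?XZ -` Q \<inter> Y -` V \<inter> space M"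
    by auto
  ultimately show ?thesis by simp
qed

text \<open>
  The joint law of the independent \<open>U\<close> and \<open>V\<close> is a product measure, so the probability of
  \<open>Q (U \<omega>) (V \<omega>)\<close> is the average of the section probabilities over the law of \<open>U\<close>.
\<close>

lemma (in prob_space) prob_le_of_sections_le:
  assumes U[measurable]: "random_variable N U" and V[measurable]: "random_variable K V"
    and ind: "\<And>A B. A \<in> sets N \<Longrightarrow> B \<in> sets K \<Longrightarrow>
      prob (U -` A \<inter> V -` B \<inter> space M) = prob (U -` A \<inter> space M) * prob (V -` B \<inter> space M)"
    and Q: "Measurable.pred (N \<Otimes>\<^sub>M K) (\<lambda>(u, v). Q u v)"
    and le: "\<And>u. u \<in> space N \<Longrightarrow> prob {\<omega> \<in> space M. Q u (V \<omega>)} \<le> c"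
  shows "prob {\<omega> \<in> space M. Q (U \<omega>) (V \<omega>)} \<le> c"
proof -
  interpret DU: prob_space "distr M N U" by (rule prob_space_distr) fact
  interpret DV: prob_space "distr M K V" by (rule prob_space_distr) fact
  have prod: "distr M N U \<Otimes>\<^sub>M distr M K V = distr M (N \<Otimes>\<^sub>M K) (\<lambda>\<omega>. (U \<omega>, V \<omega>))"
  proof (rule pair_measure_eqI)
    fix A B assume "A \<in> sets (distr M N U)" "B \<in> sets (distr M K V)"
    then have A[measurable]: "A \<in> sets N" and B[measurable]: "B \<in> sets K" by simp_all
    have "(\<lambda>\<omega>. (U \<omega>, V \<omega>)) -` (A \<times> B) \<inter> space M = U -` A \<inter> V -` B \<inter> space M" by auto
    then show "emeasure (distr M N U) A * emeasure (distr M K V) B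
        = emeasure (distr M (N \<Otimes>\<^sub>M K) (\<lambda>\<omega>. (U \<omega>, V \<omega>))) (A \<times> B)"
      by (simp add: emeasure_distr emeasure_eq_measure ind[OF A B] ennreal_mult')
  qed (simp_all add: DU.sigma_finite_measure_axioms DV.sigma_finite_measure_axioms cong: sets_pair_measure_cong)
  define E where "E = {z \<in> space (N \<Otimes>\<^sub>M K). case z of (u, v) \<Rightarrow> Q u v}"
  have E: "E \<in> sets (N \<Otimes>\<^sub>M K)"
    using Q unfolding E_def by (rule predE)
  obtain \<omega>0 where "\<omega>0 \<in> space M" using not_empty by blast
  then have "U \<omega>0 \<in> space N" by (rule measurable_space[OF U])
  from le[OF this] have c: "0 \<le> c" using measure_nonneg order_trans by blast
  have "emeasure M {\<omega> \<in> space M. Q (U \<omega>) (V \<omega>)} = emeasure (distr M (N \<Otimes>\<^sub>M K) (\<lambda>\<omega>. (U \<omega>, V \<omega>))) E"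
    using E measurable_space[OF U] measurable_space[OF V]
    by (subst emeasure_distr) (auto simp: E_def space_pair_measure intro!: arg_cong[where f = "emeasure M"])
  also have "\<dots> = (\<integral>\<^sup>+u. emeasure (distr M K V) (Pair u -` E) \<partial>distr M N U)"
    using E by (subst prod[symmetric], subst DV.emeasure_pair_measure_alt)
      (simp_all cong: sets_pair_measure_cong)
  also have "\<dots> \<le> (\<integral>\<^sup>+u. ennreal c \<partial>distr M N U)"
  proof (rule nn_integral_mono)
    fix u assume "u \<in> space (distr M N U)"
    then have u: "u \<in> space N" by simp
    have "emeasure (distr M K V) (Pair u -` E) = emeasure M {\<omega> \<in> space M. Q u (V \<omega>)}"
      using u measurable_space[OF V] emeasure_distr[OF V sets_Pair1[OF E, of u]]
      by (auto simp: E_def space_pair_measure intro!: arg_cong[where f = "emeasure M"])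
    also have "\<dots> \<le> ennreal c"
      using le[OF u] c by (simp add: emeasure_eq_measure)
    finally show "emeasure (distr M K V) (Pair u -` E) \<le> ennreal c" .
  qed
  also have "\<dots> = ennreal c"
    using DU.emeasure_space_1 by simp
  finally show ?thesis
    using c by (simp add: emeasure_eq_measure)
qed

text \<open>
  Evaluating a trajectory at a random index is measurable because the index takes finitely many
  values.
\<close>

lemma measurable_apply_index:
  assumes "finite J" "i \<in> I"
  shows "(\<lambda>z. fst z (snd z i)) \<in> (Pi\<^sub>M J (\<lambda>_. N) \<Otimes>\<^sub>M Pi\<^sub>M I (\<lambda>_. count_space J)) \<rightarrow>\<^sub>M N"
proof (rule measurable_compose_countable'[where f = "\<lambda>t z. fst z t" and g = "\<lambda>z. snd z i"])
  show "(\<lambda>z. fst z t) \<in> (Pi\<^sub>M J (\<lambda>_. N) \<Otimes>\<^sub>M Pi\<^sub>M I (\<lambda>_. count_space J)) \<rightarrow>\<^sub>M N" if "t \<in> J" for t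
    using that by measurable
  show "(\<lambda>z. snd z i) \<in> (Pi\<^sub>M J (\<lambda>_. N) \<Otimes>\<^sub>M Pi\<^sub>M I (\<lambda>_. count_space J)) \<rightarrow>\<^sub>M count_space J"
    using \<open>i \<in> I\<close> by measurable
  show "countable J" using \<open>finite J\<close> by (rule countable_finite)
qed

section \<open>Independent draws and the selection step\<close>

text \<open>
  By Markov's inequality for the law \<open>p\<close>, one draw hits a value above \<open>r * \<gamma>\<close> with probability at
  most \<open>1/r\<close>; the draws are independent.
\<close>

lemma (in prob_space) prob_all_draws_above:
  fixes a p :: "nat \<Rightarrow> real"
  assumes ind: "indep_vars (\<lambda>_. count_space {..<T}) s I" and fin: "finite I"
    and p: "\<And>i t. i \<in> I \<Longrightarrow> t < T \<Longrightarrow> prob {\<omega> \<in> space M. s i \<omega> = t} = p t"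
    and p0: "\<And>t. t < T \<Longrightarrow> 0 \<le> p t" and a0: "\<And>t. 0 \<le> a t"
    and avg: "(\<Sum>t<T. p t * a t) \<le> \<gamma>" and "0 < \<gamma>" "0 < r"
  shows "prob {\<omega> \<in> space M. \<forall>i\<in>I. r * \<gamma> < a (s i \<omega>)} \<le> (1 / r) ^ card I"
proof (cases "I = {}")
  case True
  then show ?thesis by simp
next
  case False
  define B where "B = {t \<in> {..<T}. r * \<gamma> < a t}"
  have B: "finite B" "B \<subseteq> {..<T}" by (auto simp: B_def)
  have s: "s i \<in> M \<rightarrow>\<^sub>M count_space {..<T}" if "i \<in> I" for i
    using ind that by (auto simp: indep_vars_def)
  have "(\<Sum>t\<in>B. p t) * (r * \<gamma>) \<le> (\<Sum>t\<in>B. p t * a t)"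
    unfolding sum_distrib_right using B p0
    by (intro sum_mono mult_left_mono) (auto simp: B_def)
  also have "\<dots> \<le> (\<Sum>t<T. p t * a t)"
    using B p0 a0 by (intro sum_mono2) auto
  finally have "(\<Sum>t\<in>B. p t) * r * \<gamma> \<le> 1 * \<gamma>" using avg by (simp add: mult.assoc)
  then have "(\<Sum>t\<in>B. p t) * r \<le> 1" using \<open>0 < \<gamma>\<close> by (simp only: mult_le_cancel_right_pos)
  then have tail: "(\<Sum>t\<in>B. p t) \<le> 1 / r" using \<open>0 < r\<close> by (simp add: field_simps)
  have single: "prob (s i -` B \<inter> space M) \<le> 1 / r" if "i \<in> I" for i
  proof -
    have "s i -` B \<inter> space M = (\<Union>t\<in>B. {\<omega> \<in> space M. s i \<omega> = t})" by auto
    also have "prob \<dots> = (\<Sum>t\<in>B. prob {\<omega> \<in> space M. s i \<omega> = t})"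
    proof (rule finite_measure_finite_Union)
      have "s i -` {t} \<inter> space M \<in> events" if "t \<in> B" for t
        using s[OF \<open>i \<in> I\<close>] B that by (intro measurable_sets) auto
      moreover have "s i -` {t} \<inter> space M = {\<omega> \<in> space M. s i \<omega> = t}" for t by auto
      ultimately show "(\<lambda>t. {\<omega> \<in> space M. s i \<omega> = t}) ` B \<subseteq> events" by auto
    qed (use B in \<open>auto simp: disjoint_family_on_def\<close>)
    also have "\<dots> = (\<Sum>t\<in>B. p t)"
      using p that B by (intro sum.cong) auto
    finally show ?thesis using tail by simp
  qed
  have "{\<omega> \<in> space M. \<forall>i\<in>I. r * \<gamma> < a (s i \<omega>)} = (\<Inter>i\<in>I. s i -` B \<inter> space M)"
    using False measurable_space[OF s] by (auto simp: B_def)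
  also have "prob \<dots> = (\<Prod>i\<in>I. prob (s i -` B \<inter> space M))"
    using B by (intro indep_varsD_finite[OF ind False fin]) auto
  also have "\<dots> \<le> (\<Prod>i\<in>I. 1 / r)"
    using single by (intro prod_mono) auto
  finally show ?thesis by simp
qed

text \<open>
  The inequality \<open>\<parallel>u + v\<parallel>\<^sup>2 \<le> 2\<parallel>u\<parallel>\<^sup>2 + 2\<parallel>v\<parallel>\<^sup>2\<close> is used once to pass from \<open>g y\<close> to \<open>h y\<close> and once to
  pass from \<open>h z\<close> to \<open>g z\<close>.  The second error is doubled again, whence \<open>2 + 4 = 6\<close>.
\<close>

lemma selected_norm_sq_bound:
  fixes g h :: "'a \<Rightarrow> 'b::real_inner"
  assumes sel: "(norm (h y))\<^sup>2 \<le> (norm (h z))\<^sup>2"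
    and y: "(norm (h y - g y))\<^sup>2 \<le> c" and z: "(norm (h z - g z))\<^sup>2 \<le> c"
  shows "(norm (g y))\<^sup>2 \<le> 4 * (norm (g z))\<^sup>2 + 6 * c"
proof -
  have two: "(norm (u + v))\<^sup>2 \<le> 2 * (norm u)\<^sup>2 + 2 * (norm v)\<^sup>2" for u v :: 'b
  proof -
    have "(norm (u + v))\<^sup>2 + (norm (u - v))\<^sup>2 = 2 * (norm u)\<^sup>2 + 2 * (norm v)\<^sup>2"
      by (simp add: power2_norm_eq_inner inner_simps)
    then show ?thesis using zero_le_power2[of "norm (u - v)"] by linarith
  qed
  have "(norm (g y))\<^sup>2 \<le> 2 * (norm (h y))\<^sup>2 + 2 * (norm (h y - g y))\<^sup>2"
    using two[of "h y" "g y - h y"] by (simp add: norm_minus_commute)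
  moreover have "(norm (h z))\<^sup>2 \<le> 2 * (norm (g z))\<^sup>2 + 2 * (norm (h z - g z))\<^sup>2"
    using two[of "g z" "h z - g z"] by simp
  ultimately show ?thesis
    using sel y z by linarith
qed

section \<open>The gradient at the selected iterate\<close>

theorem theorem21:
  fixes P :: "'w measure"
    and M :: "'m measure"
    and F :: "real ^ 'd \<Rightarrow> 'w \<Rightarrow> real"
    and f :: "real ^ 'd \<Rightarrow> real"
    and \<sigma> \<gamma> \<delta>_iter \<delta>_emp :: real
    and T n_iter n_emp :: nat
    and p :: "nat \<Rightarrow> real"
    and s :: "nat \<Rightarrow> 'm \<Rightarrow> nat"
    and \<xi> :: "nat \<Rightarrow> 'm \<Rightarrow> 'w"
    and x0 :: "real ^ 'd"
    and \<eta> :: "nat \<Rightarrow> 'm \<Rightarrow> real"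
    and g x :: "nat \<Rightarrow> 'm \<Rightarrow> real ^ 'd"
    and x_out :: "'m \<Rightarrow> real ^ 'd"
  assumes "prob_space P"
    and "\<And>y w. w \<in> space P \<Longrightarrow> (\<lambda>z. F z w) differentiable (at y)"
    and "\<And>y. integrable P (F y)"
    and "\<And>y. f y = (\<integral>w. F y w \<partial>P)"
    and "\<And>y. f differentiable (at y)"
    and "\<And>y. integrable P (\<lambda>w. gradient (\<lambda>z. F z w) y)"
    and "\<And>y. gradient f y = (\<integral>w. gradient (\<lambda>z. F z w) y \<partial>P)"
    and "\<sigma> > 0"
    and "\<And>y. (\<integral>\<^sup>+w. ennreal ((norm (gradient f y - gradient (\<lambda>z. F z w) y))\<^sup>2) \<partial>P) \<le> ennreal (\<sigma>\<^sup>2)"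
    and "0 < \<delta>_iter" "\<delta>_iter < 1"
    and "0 < \<delta>_emp" "\<delta>_emp < 1"
    and "\<gamma> > 0"
    and "\<And>t. t < T \<Longrightarrow> p t \<ge> 0"
    and "(\<Sum>t<T. p t) = 1"
    and "n_iter = nat \<lceil>ln (1 / \<delta>_iter)\<rceil>"
    and "n_emp = nat \<lceil>6 * (real n_iter + 1) * \<sigma>\<^sup>2 / (exp 1 * \<gamma> * \<delta>_emp)\<rceil>"
    and "prob_space M"
    \<comment> \<open>indices drawn with replacement\<close>
    and "prob_space.indep_vars M (\<lambda>_. count_space {..<T}) s {1..n_iter}"
    and "\<And>i t. i \<in> {1..n_iter} \<Longrightarrow> t < T \<Longrightarrow> \<P>(\<omega> in M. s i \<omega> = t) = p t"
    \<comment> \<open>fresh samples\<close>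
    and "prob_space.indep_vars M (\<lambda>_. P) \<xi> {1..n_emp}"
    and "\<And>j. j \<in> {1..n_emp} \<Longrightarrow> distr M P (\<xi> j) = P"
    \<comment> \<open>SGD\<close>
    and "\<And>t. g t \<in> borel_measurable M"
    and "\<And>t. \<eta> t \<in> borel_measurable M"
    and "\<And>\<omega>. \<omega> \<in> space M \<Longrightarrow> x 0 \<omega> = x0"
    and "\<And>t \<omega>. \<omega> \<in> space M \<Longrightarrow> x (Suc t) \<omega> = x t \<omega> - \<eta> t \<omega> *\<^sub>R g t \<omega>"
    and "indep_vars3 M
          (Pi\<^sub>M {1..n_iter} (\<lambda>_. count_space {..<T})) (\<lambda>\<omega>. \<lambda>i\<in>{1..n_iter}. s i \<omega>)
          (Pi\<^sub>M {1..n_emp} (\<lambda>_. P)) (\<lambda>\<omega>. \<lambda>j\<in>{1..n_emp}. \<xi> j \<omega>)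
          (Pi\<^sub>M {..<T} (\<lambda>_. borel)) (\<lambda>\<omega>. \<lambda>t\<in>{..<T}. x t \<omega>)"
    \<comment> \<open>output, with arbitrary (measurable) tie-breaking\<close>
    and "x_out \<in> borel_measurable M"
    and "\<And>\<omega>. \<omega> \<in> space M \<Longrightarrow>
          is_arg_min (\<lambda>y. (norm (empirical_gradient F n_emp (\<lambda>j. \<xi> j \<omega>) y))\<^sup>2)
            (\<lambda>y. y \<in> (\<lambda>t. x t \<omega>) ` (\<lambda>i. s i \<omega>) ` {1..n_iter}) (x_out \<omega>)"
  shows "\<P>(\<omega> in M. (norm (gradient f (x_out \<omega>)))\<^sup>2 > 5 * exp 1 * \<gamma>)
      \<le> \<P>(\<omega> in M. (\<Sum>t<T. p t * (norm (gradient f (x t \<omega>)))\<^sup>2) > \<gamma>) + \<delta>_iter + \<delta>_emp"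
proof -
  note diffF = assms(2) and intF = assms(3) and diff_f = assms(5)
    and int_grad = assms(6) and grad_f = assms(7) and var = assms(9)
    and \<delta>_iter = assms(10,11) and \<delta>_emp = assms(12,13) and \<gamma> = assms(14)
    and p0 = assms(15) and n_iter = assms(17) and n_emp = assms(18)
    and M = assms(19) and ind_s = assms(20) and law_s = assms(21)
    and ind_\<xi> = assms(22) and law_\<xi> = assms(23)
    and ind3 = assms(28) and sel = assms(30)
  interpret prob_space M by (rule M)
  let ?N = "Pi\<^sub>M {..<T} (\<lambda>_. borel :: (real ^ 'd) measure)"
  let ?K = "Pi\<^sub>M {1..n_iter} (\<lambda>_. count_space {..<T})"
  let ?L = "Pi\<^sub>M {1..n_emp} (\<lambda>_. P)"
  \<comment> \<open>The random elements as they occur in the independence hypothesis, restricted to their index sets.\<close>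
  define rx where "rx \<omega> = (\<lambda>t\<in>{..<T}. x t \<omega>)" for \<omega>
  define rs where "rs \<omega> = (\<lambda>i\<in>{1..n_iter}. s i \<omega>)" for \<omega>
  define r\<xi> where "r\<xi> \<omega> = (\<lambda>j\<in>{1..n_emp}. \<xi> j \<omega>)" for \<omega>
  have ind3': "indep_vars3 M ?K rs ?L r\<xi> ?N rx"
    using ind3 unfolding rx_def[abs_def] rs_def[abs_def] r\<xi>_def[abs_def] .
  define G where "G y = (norm (gradient f y))\<^sup>2" for y
  define D where "D y k = (norm (empirical_gradient F n_emp k y - gradient f y))\<^sup>2" for y k
  \<comment> \<open>The tolerance for which \<open>4 * (e * \<gamma>) + 6 * c = 5 * e * \<gamma>\<close>.\<close>
  define c where "c = exp 1 * \<gamma> / 6"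
  have c: "0 < c" using \<gamma> by (simp add: c_def)
  have grad_meas[measurable]: "gradient f \<in> borel_measurable borel"
    by (rule borel_measurable_gradient_of_differentiable) (rule diff_f)
  have G[measurable]: "G \<in> borel_measurable borel"
    unfolding G_def[abs_def] by measurable
  have F_meas: "F y \<in> borel_measurable P" for y using intF by auto
  have D[measurable]: "(\<lambda>z. D (fst z) (snd z)) \<in> borel_measurable (borel \<Otimes>\<^sub>M ?L)"
    using borel_measurable_empirical_gradient[OF diffF F_meas, of n_emp]
    unfolding D_def case_prod_beta by measurable
  have rx[measurable]: "rx \<in> M \<rightarrow>\<^sub>M ?N" and rs[measurable]: "rs \<in> M \<rightarrow>\<^sub>M ?K" and r\<xi>[measurable]: "r\<xi> \<in> M \<rightarrow>\<^sub>M ?L"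
    using ind3' by (auto simp: indep_vars3_def)
  have x[measurable]: "x t \<in> borel_measurable M" if "t < T" for t
    using measurable_compose[OF rx measurable_component_singleton[of t]] that by (simp add: rx_def)
  have s_range: "s i \<omega> < T" if "i \<in> {1..n_iter}" "\<omega> \<in> space M" for i \<omega>
    using measurable_space[OF rs that(2)] that(1) by (auto simp: rs_def space_PiM)
  have picked: "(\<lambda>\<omega>. rx \<omega> (rs \<omega> i)) \<in> borel_measurable M" if "i \<in> {1..n_iter}" for i
    using measurable_compose[OF measurable_Pair[OF rx rs] measurable_apply_index[OF _ that]] by simp
  have picked_eq: "rx \<omega> (rs \<omega> i) = x (s i \<omega>) \<omega>" if "i \<in> {1..n_iter}" "\<omega> \<in> space M" for i \<omega>
    using s_range[OF that] that by (simp add: rx_def rs_def)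

  have \<delta>_bound: "exp (- real n_iter) \<le> \<delta>_iter"
  proof -
    have "ln (1 / \<delta>_iter) \<le> real n_iter" unfolding n_iter by linarith
    then have "- real n_iter \<le> ln \<delta>_iter" using \<delta>_iter by (simp add: ln_div)
    then have "exp (- real n_iter) \<le> exp (ln \<delta>_iter)" by simp
    then show ?thesis using \<delta>_iter by simp
  qed

  let ?A = "{\<omega> \<in> space M. (\<Sum>t<T. p t * G (x t \<omega>)) > \<gamma>}"
  let ?B = "{\<omega> \<in> space M. (\<Sum>t<T. p t * G (rx \<omega> t)) \<le> \<gamma> \<and> (\<forall>i\<in>{1..n_iter}. exp 1 * \<gamma> < G (rx \<omega> (rs \<omega> i)))}"
  let ?C = "\<lambda>i. {\<omega> \<in> space M. c < D (rx \<omega> (rs \<omega> i)) (r\<xi> \<omega>)}"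
  \<comment> \<open>The indices are fresh given the trajectory: condition on the latter.\<close>
  have B: "prob ?B \<le> \<delta>_iter"
  proof (rule prob_le_of_sections_le[OF rx rs prob_vimages_third_first[OF ind3']])
    have [measurable]: "(\<lambda>z. fst z (snd z i)) \<in> (?N \<Otimes>\<^sub>M ?K) \<rightarrow>\<^sub>M borel" if "i \<in> {1..n_iter}" for i
      by (rule measurable_apply_index) (use that in auto)
    show "Measurable.pred (?N \<Otimes>\<^sub>M ?K) (\<lambda>(v, u). (\<Sum>t<T. p t * G (v t)) \<le> \<gamma> \<and>
        (\<forall>i\<in>{1..n_iter}. exp 1 * \<gamma> < G (v (u i))))"
      unfolding case_prod_beta by measurable
  next
    fix v :: "nat \<Rightarrow> real ^ 'd"
    show "prob {\<omega> \<in> space M. (\<Sum>t<T. p t * G (v t)) \<le> \<gamma> \<and>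
        (\<forall>i\<in>{1..n_iter}. exp 1 * \<gamma> < G (v (rs \<omega> i)))} \<le> \<delta>_iter"
    proof (cases "(\<Sum>t<T. p t * G (v t)) \<le> \<gamma>")
      case True
      have "prob {\<omega> \<in> space M. \<forall>i\<in>{1..n_iter}. exp 1 * \<gamma> < G (v (s i \<omega>))} \<le> (1 / exp 1) ^ card {1..n_iter}"
        by (rule prob_all_draws_above[where a = "\<lambda>t. G (v t)" and p = p, OF ind_s])
           (use True law_s p0 \<gamma> in \<open>auto simp: G_def\<close>)
      also have "\<dots> = exp (- real n_iter)"
        by (simp add: exp_minus power_divide exp_of_nat_mult[symmetric] inverse_eq_divide)
      also have "{\<omega> \<in> space M. \<forall>i\<in>{1..n_iter}. exp 1 * \<gamma> < G (v (s i \<omega>))}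
          = {\<omega> \<in> space M. \<forall>i\<in>{1..n_iter}. exp 1 * \<gamma> < G (v (rs \<omega> i))}"
        by (auto simp: rs_def)
      finally show ?thesis using True \<delta>_bound by simp
    next
      case False
      then show ?thesis using \<delta>_iter by simp
    qed
  qed
  have n_emp_pos: "0 < n_emp"
    using \<gamma> \<delta>_emp \<open>\<sigma> > 0\<close> unfolding n_emp by (simp add: divide_pos_pos)
  have \<sigma>_bound: "\<sigma>\<^sup>2 / (real n_emp * c) \<le> \<delta>_emp / (real n_iter + 1)"
  proof -
    have "6 * (real n_iter + 1) * \<sigma>\<^sup>2 / (exp 1 * \<gamma> * \<delta>_emp) \<le> real n_emp"
      unfolding n_emp by linarith
    then show ?thesis
      using \<gamma> \<delta>_emp n_emp_pos by (simp add: c_def field_simps)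
  qed
  \<comment> \<open>A drawn iterate depends only on the indices and the trajectory, so the samples are fresh given it.\<close>
  have C: "prob (?C i) \<le> \<delta>_emp / (real n_iter + 1)" if i: "i \<in> {1..n_iter}" for i
  proof -
    have pick: "(\<lambda>z. snd z (fst z i)) \<in> (?K \<Otimes>\<^sub>M ?N) \<rightarrow>\<^sub>M borel"
      using measurable_compose[OF measurable_Pair[OF measurable_snd measurable_fst]
          measurable_apply_index[OF _ i, of "{..<T}" borel]] by simp
    show ?thesis
    proof (rule prob_le_of_sections_le[OF picked[OF i] r\<xi>])
      fix A :: "(real ^ 'd) set" and V assume A: "A \<in> sets borel" and V: "V \<in> sets ?L"
      let ?Q = "(\<lambda>z. snd z (fst z i)) -` A \<inter> space (?K \<Otimes>\<^sub>M ?N)"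
      have "(\<lambda>\<omega>. rx \<omega> (rs \<omega> i)) -` A \<inter> H \<inter> space M = (\<lambda>\<omega>. (rs \<omega>, rx \<omega>)) -` ?Q \<inter> H \<inter> space M" for H
        using measurable_space[OF rx] measurable_space[OF rs] by (auto simp: space_pair_measure)
      from this[of "r\<xi> -` V"] this[of UNIV]
        prob_vimages_pair_second[OF ind3' measurable_sets[OF pick A] V]
      show "prob ((\<lambda>\<omega>. rx \<omega> (rs \<omega> i)) -` A \<inter> r\<xi> -` V \<inter> space M)
          = prob ((\<lambda>\<omega>. rx \<omega> (rs \<omega> i)) -` A \<inter> space M) * prob (r\<xi> -` V \<inter> space M)"
        by simp
    next
      show "Measurable.pred (borel \<Otimes>\<^sub>M ?L) (\<lambda>(y, k). c < D y k)"
        unfolding case_prod_beta by measurable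
    next
      fix y :: "real ^ 'd"
      have "D y (r\<xi> \<omega>) = (norm ((1 / real n_emp) *\<^sub>R (\<Sum>j\<in>{1..n_emp}. gradient (\<lambda>z. F z (\<xi> j \<omega>)) y)
          - gradient f y))\<^sup>2" for \<omega>
        by (simp add: D_def empirical_gradient_def r\<xi>_def)
      then have "prob {\<omega> \<in> space M. c < D y (r\<xi> \<omega>)} \<le> \<sigma>\<^sup>2 / (real n_emp * c)"
        using prob_sample_mean_deviation[OF ind_\<xi> law_\<xi> int_grad grad_f var n_emp_pos c, of y] by simp
      then show "prob {\<omega> \<in> space M. c < D y (r\<xi> \<omega>)} \<le> \<delta>_emp / (real n_iter + 1)"
        using \<sigma>_bound by linarith
    qed
  qed

  have A_sets: "?A \<in> events" by measurable
  have B_sets: "?B \<in> events" using picked by measurable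
  have C_sets: "?C i \<in> events" if "i \<in> {1..n_iter}" for i
  proof -
    have "(\<lambda>\<omega>. D (rx \<omega> (rs \<omega> i)) (r\<xi> \<omega>)) \<in> borel_measurable M"
      using measurable_compose[OF measurable_Pair[OF picked[OF that] r\<xi>] D] by simp
    then show ?thesis by measurable
  qed
  have UC_sets: "(\<Union>i\<in>{1..n_iter}. ?C i) \<in> events"
    by (rule sets.finite_UN) (simp, use C_sets in blast)
  have sub: "{\<omega> \<in> space M. 5 * exp 1 * \<gamma> < G (x_out \<omega>)} \<subseteq> ?A \<union> (?B \<union> (\<Union>i\<in>{1..n_iter}. ?C i))"
  proof (rule subsetI, rule ccontr)
    fix \<omega>
    assume "\<omega> \<in> {\<omega> \<in> space M. 5 * exp 1 * \<gamma> < G (x_out \<omega>)}"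
      and out: "\<omega> \<notin> ?A \<union> (?B \<union> (\<Union>i\<in>{1..n_iter}. ?C i))"
    then have \<omega>: "\<omega> \<in> space M" and large: "5 * exp 1 * \<gamma> < G (x_out \<omega>)" by auto
    define E where "E = empirical_gradient F n_emp (\<lambda>j. \<xi> j \<omega>)"
    have D_E: "D y (r\<xi> \<omega>) = (norm (E y - gradient f y))\<^sup>2" for y
      by (simp add: D_def E_def empirical_gradient_def r\<xi>_def)
    have "(\<Sum>t<T. p t * G (x t \<omega>)) \<le> \<gamma>" using out \<omega> by auto
    then have "(\<Sum>t<T. p t * G (rx \<omega> t)) \<le> \<gamma>" by (simp add: rx_def)
    then obtain i where i: "i \<in> {1..n_iter}" and "\<not> exp 1 * \<gamma> < G (rx \<omega> (rs \<omega> i))"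
      using out \<omega> by blast
    then have small: "G (x (s i \<omega>) \<omega>) \<le> exp 1 * \<gamma>"
      using picked_eq[OF i \<omega>] by simp
    obtain j where j: "j \<in> {1..n_iter}" "x_out \<omega> = x (s j \<omega>) \<omega>"
      using sel[OF \<omega>] unfolding is_arg_min_def by blast
    have close: "(norm (E (x (s k \<omega>) \<omega>) - gradient f (x (s k \<omega>) \<omega>)))\<^sup>2 \<le> c" if "k \<in> {1..n_iter}" for k
    proof -
      have "\<not> c < D (rx \<omega> (rs \<omega> k)) (r\<xi> \<omega>)"
        using out \<omega> that by blast
      then show ?thesis
        by (simp add: picked_eq[OF that \<omega>] D_E)
    qed
    have "(norm (E (x_out \<omega>)))\<^sup>2 \<le> (norm (E (x (s i \<omega>) \<omega>)))\<^sup>2"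
      using sel[OF \<omega>] i unfolding is_arg_min_linorder E_def by blast
    from selected_norm_sq_bound[where g = "gradient f", OF this _ close[OF i]] close[OF j(1)] j(2)
    have "G (x_out \<omega>) \<le> 4 * G (x (s i \<omega>) \<omega>) + 6 * c" by (simp add: G_def)
    also have "\<dots> \<le> 5 * exp 1 * \<gamma>" using small by (simp add: c_def algebra_simps)
    finally show False using large by simp
  qed
  have "prob {\<omega> \<in> space M. 5 * exp 1 * \<gamma> < G (x_out \<omega>)} \<le> prob (?A \<union> (?B \<union> (\<Union>i\<in>{1..n_iter}. ?C i)))"
    by (rule finite_measure_mono[OF sub sets.Un[OF A_sets sets.Un[OF B_sets UC_sets]]])
  also have "\<dots> \<le> prob ?A + prob (?B \<union> (\<Union>i\<in>{1..n_iter}. ?C i))"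
    by (rule measure_Un_le[OF A_sets sets.Un[OF B_sets UC_sets]])
  also have "prob (?B \<union> (\<Union>i\<in>{1..n_iter}. ?C i)) \<le> prob ?B + prob (\<Union>i\<in>{1..n_iter}. ?C i)"
    by (rule measure_Un_le[OF B_sets UC_sets])
  also have "prob (\<Union>i\<in>{1..n_iter}. ?C i) \<le> (\<Sum>i\<in>{1..n_iter}. prob (?C i))"
    by (rule finite_measure_subadditive_finite) (simp, use C_sets in blast)
  also have "\<dots> \<le> (\<Sum>i\<in>{1..n_iter}. \<delta>_emp / (real n_iter + 1))"
    by (rule sum_mono) (rule C)
  \<comment> \<open>Summing \<open>n_iter\<close> terms costs less than the factor \<open>n_iter + 1\<close> in the choice of \<open>n_emp\<close>.\<close>
  also have "\<dots> \<le> \<delta>_emp"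
    using \<delta>_emp by (simp add: field_simps)
  finally show ?thesis
    using B by (simp add: G_def)
qed

end
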